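(* Let $n\ge 0$ be an integer, let $\alpha,\beta>-1$ be real, let $\lambda$ be a nonzero complex number, let $P_n^{(\alpha,\beta)}$ be the Jacobi polynomial, and put $\widehat{P_n^{(\alpha,\beta)}}(\lambda)=\int_{-1}^{1}P_n^{(\alpha,\beta)}(x)e^{i\lambda x}\,dx$. Then $$\widehat{P_n^{(\alpha,\beta)}}(\lambda)=\frac{(\beta+1)_n}{i\lambda\, n!}(-1)^{n+1}e^{-i\lambda}\,{}_3F_1\!\left(n+\alpha+\beta+1,-n,1;\,\beta+1;\,\frac{-1}{2i\lambda}\right)+\frac{(\alpha+1)_n}{i\lambda\, n!}e^{i\lambda}\,{}_3F_1\!\left(n+\alpha+\beta+1,-n,1;\,\alpha+1;\,\frac{1}{2i\lambda}\right).$$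
   Context: The Jacobi polynomials are $P_n^{(\alpha,\beta)}(x)=\frac{1}{2^n}\sum_{k=0}^{n}\binom{\alpha+n}{k}\binom{\beta+n}{n-k}(x-1)^{n-k}(x+1)^k$, where $\binom{r}{m}=\frac{r(r-1)\cdots(r-m+1)}{m!}$. They are orthogonal on $[-1,1]$ with respect to the weight $(1-x)^\alpha(1+x)^\beta$. The shifted factorial is $(a)_0=1$, $(a)_m=a(a+1)\cdots(a+m-1)$. The hypergeometric expression is the terminating sum ${}_3F_1(a,-n,c;\,d;\,z)=\sum_{k=0}^{n}\frac{(a)_k(-n)_k(c)_k}{(d)_k\,k!}z^k$. *)

theory Defs
  imports "HOL-Analysis.Analysis"
begin

definition jacobi_P :: "nat \<Rightarrow> real \<Rightarrow> real \<Rightarrow> real \<Rightarrow> real" where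
  "jacobi_P n \<alpha> \<beta> x =
     1 / 2 ^ n * (\<Sum>k=0..n. ((\<alpha> + real n) gchoose k) * ((\<beta> + real n) gchoose (n - k))
                    * (x - 1) ^ (n - k) * (x + 1) ^ k)"

(* The terminating series 3F1(a, -n, c; d; z): the second numerator parameter is -n, so
   the argument n is the natural number itself. *)
definition hyp3F1_term :: "complex \<Rightarrow> nat \<Rightarrow> complex \<Rightarrow> complex \<Rightarrow> complex \<Rightarrow> complex" where
  "hyp3F1_term a n c d z =
     (\<Sum>k=0..n. pochhammer a k * pochhammer (- of_nat n) k * pochhammer c k
                / (pochhammer d k * fact k) * z ^ k)"

(* The frequency lambda is written \<xi>, as the Greek lambda is the binder token. *)
definition jacobi_hat :: "nat \<Rightarrow> real \<Rightarrow> real \<Rightarrow> complex \<Rightarrow> complex" where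
  "jacobi_hat n \<alpha> \<beta> \<xi> =
     integral {-1..1} (\<lambda>x::real. of_real (jacobi_P n \<alpha> \<beta> x) * exp (\<i> * \<xi> * of_real x))"

end

theory Submission
  imports Defs
begin

text \<open>
  Integrating by parts until the polynomial is exhausted leaves only the derivatives of
  \<open>P\<close> at the endpoints, which are read off from its Taylor expansions there. Writing
  \<open>(x + 1) / 2 = 1 + (x - 1) / 2\<close> and expanding, trinomial revision and Vandermonde's identity
  give the coefficients at \<open>1\<close>; those at \<open>-1\<close> follow from the reflection
  \<open>x \<mapsto> - x\<close>, \<open>\<alpha> \<leftrightarrow> \<beta>\<close>.
\<close>

text \<open>With u = (x - 1) / 2 the left side is the Jacobi polynomial. Reversing the sum by i = n
  - k, expanding (1 + u)^(n - i) and collecting the power m = i + j leaves, for each m, a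
  convolution over i.\<close>

lemma gbinomial_product_expansion:
  fixes a b u :: "'a :: field_char_0"
  shows "(\<Sum>k\<le>n. (a + of_nat n gchoose k) * (b + of_nat n gchoose (n - k)) * u ^ (n - k) * (1 + u) ^ k)
    = (\<Sum>m\<le>n. (a + of_nat n gchoose (n - m)) * (a + b + of_nat n + of_nat m gchoose m) * u ^ m)"
proof -
  define g where "g = (\<lambda>i j. (a + of_nat n gchoose (n - i)) * (b + of_nat n gchoose i)
    * of_nat ((n - i) choose j) * u ^ (i + j))"
  have inner: "(\<Sum>i\<le>m. g i (m - i))
      = (a + of_nat n gchoose (n - m)) * (a + b + of_nat n + of_nat m gchoose m) * u ^ m"
    if "m \<le> n" for m
  proof -
    have "g i (m - i) = (a + of_nat n gchoose (n - m)) * u ^ m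
        * ((b + of_nat n gchoose i) * (a + of_nat m gchoose (m - i)))" if "i \<le> m" for i
    proof -
      \<comment> \<open>The lower index becomes n - m, the form that trinomial revision takes. The
        revision then pulls out a factor free of i, and what remains is a Vandermonde
        convolution.\<close>
      have "(n - i) choose (m - i) = (n - i) choose (n - m)"
        using \<open>m \<le> n\<close> that binomial_symmetric[of "m - i" "n - i"] by simp
      moreover have "(a + of_nat n gchoose (n - i)) * of_nat ((n - i) choose (n - m))
          = (a + of_nat n gchoose (n - m)) * (a + of_nat m gchoose (m - i))"
        using gbinomial_trinomial_revision[of "n - m" "n - i" "a + of_nat n"] \<open>m \<le> n\<close> that
        by (simp add: binomial_gbinomial of_nat_diff)
      ultimately show ?thesis
        using that unfolding g_def by (simp add: mult_ac)
    qed
    then have "(\<Sum>i\<le>m. g i (m - i)) = (a + of_nat n gchoose (n - m)) * u ^ m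
        * (\<Sum>i\<le>m. (b + of_nat n gchoose i) * (a + of_nat m gchoose (m - i)))"
      by (simp add: sum_distrib_left)
    also have "(\<Sum>i\<le>m. (b + of_nat n gchoose i) * (a + of_nat m gchoose (m - i)))
        = (a + b + of_nat n + of_nat m gchoose m)"
      using gbinomial_Vandermonde[of "b + of_nat n" "a + of_nat m" m]
      by (simp add: atLeast0AtMost add_ac)
    finally show ?thesis by (simp add: mult_ac)
  qed
  have "(\<Sum>k\<le>n. (a + of_nat n gchoose k) * (b + of_nat n gchoose (n - k)) * u ^ (n - k) * (1 + u) ^ k)
      = (\<Sum>i\<le>n. (a + of_nat n gchoose (n - i)) * (b + of_nat n gchoose i) * u ^ i * (1 + u) ^ (n - i))"
    by (rule sum.reindex_bij_witness[of _ "\<lambda>i. n - i" "\<lambda>i. n - i"]) auto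
  also have "\<dots> = (\<Sum>i\<le>n. \<Sum>j\<le>n - i. g i j)"
  proof (rule sum.cong)
    fix i
    have "(1 + u) ^ (n - i) = (\<Sum>j\<le>n - i. of_nat ((n - i) choose j) * u ^ j)"
      using binomial_ring[of u 1 "n - i"] by (simp add: add.commute)
    then show "(a + of_nat n gchoose (n - i)) * (b + of_nat n gchoose i) * u ^ i * (1 + u) ^ (n - i)
        = (\<Sum>j\<le>n - i. g i j)"
      by (simp add: g_def sum_distrib_left power_add mult_ac)
  qed simp
  also have "\<dots> = (\<Sum>(i,j)\<in>{(i,j). i + j \<le> n}. g i j)"
    by (subst sum.Sigma) (auto intro!: sum.cong)
  also have "\<dots> = (\<Sum>m\<le>n. \<Sum>i\<le>m. g i (m - i))"
    by (rule sum.triangle_reindex_eq)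
  also have "\<dots> = (\<Sum>m\<le>n. (a + of_nat n gchoose (n - m))
      * (a + b + of_nat n + of_nat m gchoose m) * u ^ m)"
    by (intro sum.cong) (auto simp: inner)
  finally show ?thesis .
qed

lemma jacobi_P_expand_at_1:
  "jacobi_P n \<alpha> \<beta> x = (\<Sum>m\<le>n. (\<alpha> + real n gchoose (n - m))
      * (\<alpha> + \<beta> + real n + real m gchoose m) * ((x - 1) / 2) ^ m)"
proof -
  have "jacobi_P n \<alpha> \<beta> x = (\<Sum>k\<le>n. (\<alpha> + real n gchoose k) * (\<beta> + real n gchoose (n - k))
      * ((x - 1) / 2) ^ (n - k) * (1 + (x - 1) / 2) ^ k)"
    unfolding jacobi_P_def sum_distrib_left atLeast0AtMost
  proof (rule sum.cong)
    fix k assume "k \<in> {..n}"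
    \<comment> \<open>The prefactor 1 / 2^n is shared out: one half for each of the n - k factors x
      - 1 and each of the k factors x + 1.\<close>
    then have "(2::real) ^ n = 2 ^ (n - k) * 2 ^ k"
      by (simp flip: power_add)
    moreover have *: "1 + (x - 1) / 2 = (x + 1) / 2"
      by (simp add: field_simps)
    ultimately show "1 / 2 ^ n * ((\<alpha> + real n gchoose k) * (\<beta> + real n gchoose (n - k))
          * (x - 1) ^ (n - k) * (x + 1) ^ k)
        = (\<alpha> + real n gchoose k) * (\<beta> + real n gchoose (n - k))
          * ((x - 1) / 2) ^ (n - k) * (1 + (x - 1) / 2) ^ k"
      unfolding * by (simp add: power_divide)
  qed simp
  then show ?thesis
    by (simp add: gbinomial_product_expansion)
qed

text \<open>Replacing k by n - k exchanges the two binomials and the roles of x - 1 and x + 1. The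
  signs pulled out of the powers at - x amount to (-1)^n in every term, which the prefactor
  cancels.\<close>

lemma jacobi_P_reflect: "jacobi_P n \<alpha> \<beta> x = (-1) ^ n * jacobi_P n \<beta> \<alpha> (- x)"
proof -
  have "(-1) ^ n * (\<Sum>k\<le>n. (\<beta> + real n gchoose k) * (\<alpha> + real n gchoose (n - k))
          * (- x - 1) ^ (n - k) * (- x + 1) ^ k)
      = (\<Sum>k\<le>n. (\<alpha> + real n gchoose k) * (\<beta> + real n gchoose (n - k))
          * (x - 1) ^ (n - k) * (x + 1) ^ k)"
    unfolding sum_distrib_left
  proof (rule sum.reindex_bij_witness[of _ "\<lambda>k. n - k" "\<lambda>k. n - k"])
    fix k assume "k \<in> {..n}"
    define R where "R = (\<alpha> + real n gchoose (n - k)) * (\<beta> + real n gchoose (n - (n - k)))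
          * (x - 1) ^ (n - (n - k)) * (x + 1) ^ (n - k)"
    have "(- x - 1) ^ (n - k) = (-1) ^ (n - k) * (x + 1) ^ (n - k)"
      "(- x + 1) ^ k = (-1) ^ k * (x - 1) ^ k"
      by (simp_all flip: power_mult_distrib)
    then have "(-1) ^ n * ((\<beta> + real n gchoose k) * (\<alpha> + real n gchoose (n - k))
          * (- x - 1) ^ (n - k) * (- x + 1) ^ k)
        = (-1) ^ n * ((-1) ^ (n - k) * (-1) ^ k) * R"
      using \<open>k \<in> {..n}\<close> unfolding R_def by (simp only: mult_ac) simp
    moreover have "(-1) ^ n * ((-1) ^ (n - k) * (-1) ^ k) = (1 :: real)"
      using \<open>k \<in> {..n}\<close> by (simp flip: power_add)
    ultimately show "(\<alpha> + real n gchoose (n - k)) * (\<beta> + real n gchoose (n - (n - k)))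
          * (x - 1) ^ (n - (n - k)) * (x + 1) ^ (n - k)
        = (-1) ^ n * ((\<beta> + real n gchoose k) * (\<alpha> + real n gchoose (n - k))
          * (- x - 1) ^ (n - k) * (- x + 1) ^ k)"
      unfolding R_def by (simp only: mult_1)
  qed auto
  then show ?thesis
    by (simp add: jacobi_P_def atLeast0AtMost)
qed

text \<open>The left side is the k-th derivative at 0 of the expansion in (x - 1) / 2. The right
  side shows no k! because in the 3F1 series the parameter 1 contributes (1)_k = k!, which cancels
  the k! below. The bound on \<alpha> keeps the denominator positive.\<close>

lemma jacobi_coefficient_pochhammer:
  fixes \<alpha> \<beta> :: real
  assumes "\<alpha> > -1" "k \<le> n"
  shows "fact k * ((\<alpha> + real n gchoose (n - k)) * (\<alpha> + \<beta> + real n + real k gchoose k))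
    = pochhammer (\<alpha> + 1) n / fact n * (-1) ^ k
      * (pochhammer (real n + \<alpha> + \<beta> + 1) k * pochhammer (- real n) k / pochhammer (\<alpha> + 1) k)"
proof -
  have binom1: "fact k * (\<alpha> + \<beta> + real n + real k gchoose k) = pochhammer (real n + \<alpha> + \<beta> + 1) k"
    by (simp add: gbinomial_pochhammer' add_ac)
  have binom2: "(\<alpha> + real n gchoose (n - k)) = pochhammer (\<alpha> + 1 + real k) (n - k) / fact (n - k)"
    using assms by (simp add: gbinomial_pochhammer' of_nat_diff algebra_simps)
  have split: "pochhammer (\<alpha> + 1) n = pochhammer (\<alpha> + 1) k * pochhammer (\<alpha> + 1 + real k) (n - k)"
    using assms by (intro pochhammer_product)
  \<comment> \<open>The product (-n)_k is (-1)^k n (n - 1) ... (n - k + 1), the top k factors of n!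
    up to sign. As a factor of n! it is nonzero, so it can be cancelled below.\<close>
  have fact_n: "fact n = (-1) ^ k * pochhammer (- real n) k * fact (n - k)"
  proof -
    have "fact n = pochhammer 1 (n - k) * pochhammer (1 + real (n - k)) k"
      using assms pochhammer_product'[of "1::real" "n - k" k] by (simp add: pochhammer_fact)
    then show ?thesis
      using assms by (simp add: pochhammer_minus pochhammer_fact of_nat_diff algebra_simps)
  qed
  have "pochhammer (\<alpha> + 1) k > 0"
    using assms by (intro pochhammer_pos) auto
  moreover have "pochhammer (- real n) k \<noteq> 0"
    using fact_n by (metis fact_nonzero mult_zero_left mult_zero_right)
  moreover have "fact k * ((\<alpha> + real n gchoose (n - k)) * (\<alpha> + \<beta> + real n + real k gchoose k))
      = pochhammer (\<alpha> + 1 + real k) (n - k) / fact (n - k) * pochhammer (real n + \<alpha> + \<beta> + 1) k"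
    unfolding binom1[symmetric] binom2 by simp
  ultimately show ?thesis
    unfolding split fact_n by simp
qed

text \<open>Differentiation commutes with the shift x - s, so the value at s is that of the k-th
  derivative of \<open>q\<close> at 0. This reads endpoint derivatives off Taylor
  coefficients.\<close>

lemma poly_higher_pderiv_shift:
  fixes q :: "'a :: {idom, semiring_char_0} poly"
  shows "poly ((pderiv ^^ k) (q \<circ>\<^sub>p [:- s, 1:])) s = fact k * coeff q k"
proof -
  have "(pderiv ^^ k) (q \<circ>\<^sub>p [:- s, 1:]) = (pderiv ^^ k) q \<circ>\<^sub>p [:- s, 1:]"
    by (induction k) (simp_all add: pderiv_pcompose pderiv_pCons)
  then show ?thesis
    by (simp add: poly_pcompose poly_0_coeff_0 coeff_higher_pderiv pochhammer_fact)
qed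

text \<open>\<open>F\<close> is the antiderivative that repeated integration by parts produces; its
  derivative telescopes to the integrand.\<close>

lemma has_integral_poly_exp:
  fixes p :: "real poly" and \<mu> :: complex
  assumes "degree p \<le> n" "\<mu> \<noteq> 0" "a \<le> b"
  defines "F \<equiv> \<lambda>x. exp (\<mu> * of_real x) / \<mu>
    * (\<Sum>k\<le>n. of_real (poly ((pderiv ^^ k) p) x) * (- 1 / \<mu>) ^ k)"
  shows "((\<lambda>x. of_real (poly p x) * exp (\<mu> * of_real x)) has_integral (F b - F a)) {a..b}"
proof (rule fundamental_theorem_of_calculus)
  fix x
  define d where "d = (\<lambda>k. complex_of_real (poly ((pderiv ^^ k) p) x))"
  \<comment> \<open>The n-th derivative is constant, so the next one vanishes; this removes the far
    end of the telescope.\<close>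
  have "degree ((pderiv ^^ n) p) = 0"
    using assms(1) by (simp add: degree_higher_pderiv)
  then have "d (Suc n) = 0"
    by (simp add: d_def pderiv_eq_0_iff[THEN iffD2])
  have "(F has_vector_derivative (exp (\<mu> * of_real x) * (\<Sum>k\<le>n. d k * (- 1 / \<mu>) ^ k)
      + exp (\<mu> * of_real x) / \<mu> * (\<Sum>k\<le>n. d (Suc k) * (- 1 / \<mu>) ^ k))) (at x within {a..b})"
  proof -
    have D: "((\<lambda>x. complex_of_real (poly ((pderiv ^^ k) p) x)) has_vector_derivative d (Suc k))
        (at x within {a..b})" for k
      unfolding d_def
      by (intro has_vector_derivative_of_real has_real_derivative_iff_has_vector_derivative[THEN iffD1])
        (auto intro!: derivative_eq_intros)
    have E: "((\<lambda>x. exp (\<mu> * of_real x) / \<mu>) has_vector_derivative exp (\<mu> * of_real x))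
        (at x within {a..b})"
      using \<open>\<mu> \<noteq> 0\<close> by (auto intro!: derivative_eq_intros has_vector_derivative_real_field)
    have "((\<lambda>x. \<Sum>k\<le>n. of_real (poly ((pderiv ^^ k) p) x) * (- 1 / \<mu>) ^ k)
        has_vector_derivative (\<Sum>k\<le>n. d (Suc k) * (- 1 / \<mu>) ^ k)) (at x within {a..b})"
      by (intro has_vector_derivative_sum has_vector_derivative_mult_left D)
    from has_vector_derivative_mult[OF E this] show ?thesis
      unfolding F_def by (simp add: d_def add.commute)
  qed
  \<comment> \<open>Writing 1 / \<mu> as -(-1 / \<mu>) turns the second sum into the first with its
    index shifted by one and a minus sign.\<close>
  also have "exp (\<mu> * of_real x) * (\<Sum>k\<le>n. d k * (- 1 / \<mu>) ^ k)
      + exp (\<mu> * of_real x) / \<mu> * (\<Sum>k\<le>n. d (Suc k) * (- 1 / \<mu>) ^ k)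
    = exp (\<mu> * of_real x) * (\<Sum>k\<le>n. d k * (- 1 / \<mu>) ^ k - d (Suc k) * (- 1 / \<mu>) ^ Suc k)"
    by (simp add: sum_distrib_left algebra_simps flip: sum.distrib)
  also have "(\<Sum>k\<le>n. d k * (- 1 / \<mu>) ^ k - d (Suc k) * (- 1 / \<mu>) ^ Suc k) = d 0"
    by (subst sum_telescope) (simp add: \<open>d (Suc n) = 0\<close>)
  finally show "(F has_vector_derivative of_real (poly p x) * exp (\<mu> * of_real x)) (at x within {a..b})"
    by (simp add: d_def mult.commute)
qed fact

theorem theorem3p1:
  fixes n :: nat and \<alpha> \<beta> :: real and \<xi> :: complex
  assumes "\<alpha> > -1" and "\<beta> > -1" and "\<xi> \<noteq> 0"
  shows "jacobi_hat n \<alpha> \<beta> \<xi> =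
      of_real (pochhammer (\<beta> + 1) n) / (\<i> * \<xi> * fact n) * (-1) ^ (n + 1) * exp (- \<i> * \<xi>)
        * hyp3F1_term (of_real (real n + \<alpha> + \<beta> + 1)) n 1 (of_real (\<beta> + 1)) (- 1 / (2 * \<i> * \<xi>))
    + of_real (pochhammer (\<alpha> + 1) n) / (\<i> * \<xi> * fact n) * exp (\<i> * \<xi>)
        * hyp3F1_term (of_real (real n + \<alpha> + \<beta> + 1)) n 1 (of_real (\<alpha> + 1)) (1 / (2 * \<i> * \<xi>))"
proof -
  \<comment> \<open>\<open>c\<close> takes both parameters as arguments since the expansion at -1
    uses it with them exchanged. The variable is x - 1 in \<open>q\<close> and x + 1 in
    \<open>r\<close>, hence the powers of 1/2 and of -1/2.\<close>
  define c where "c = (\<lambda>\<alpha> \<beta> m. (\<alpha> + real n gchoose (n - m))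
    * (\<alpha> + \<beta> + real n + real m gchoose m))"
  define q where "q = (\<Sum>m\<le>n. monom (c \<alpha> \<beta> m / 2 ^ m) m)"
  define r where "r = (\<Sum>m\<le>n. monom ((-1) ^ n * c \<beta> \<alpha> m * (-1 / 2) ^ m) m)"
  define p where "p = q \<circ>\<^sub>p [:- 1, 1:]"
  have coeff_q: "coeff q k = c \<alpha> \<beta> k / 2 ^ k" if "k \<le> n" for k
    using that by (simp add: q_def coeff_sum)
  have coeff_r: "coeff r k = (-1) ^ n * c \<beta> \<alpha> k * (-1 / 2) ^ k" if "k \<le> n" for k
    using that by (simp add: r_def coeff_sum)
  have "degree q \<le> n"
    unfolding q_def by (intro degree_sum_le) (auto intro: order_trans[OF degree_monom_le])
  then have "degree p \<le> n"
    by (simp add: p_def degree_pcompose)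
  have p: "poly p x = jacobi_P n \<alpha> \<beta> x" for x
    by (simp add: p_def q_def c_def poly_pcompose poly_sum poly_monom jacobi_P_expand_at_1 power_divide)
  \<comment> \<open>The shift is written with - (- 1) to match
    \<open>poly_higher_pderiv_shift\<close> at s = -1.\<close>
  have "poly (r \<circ>\<^sub>p [:- (- 1), 1:]) x = jacobi_P n \<alpha> \<beta> x" for x
  proof -
    have "((- x - 1) / 2) ^ m = (-1 / 2) ^ m * (x + 1) ^ m" for m
      unfolding power_mult_distrib[symmetric] by (rule arg_cong[of _ _ "\<lambda>t. t ^ m"]) (simp add: field_simps)
    then show ?thesis
      unfolding jacobi_P_reflect[of n \<alpha>] jacobi_P_expand_at_1[of n \<beta>]
      by (simp add: r_def c_def poly_pcompose poly_sum poly_monom sum_distrib_left mult_ac add.commute[of 1 x])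
  qed
  then have p': "p = r \<circ>\<^sub>p [:- (- 1), 1:]"
    by (simp add: p poly_eq_poly_eq_iff[symmetric] fun_eq_iff)
  have c: "of_real (fact k * c \<alpha> \<beta> k) = of_real (pochhammer (\<alpha> + 1) n) / fact n * (-1) ^ k
      * (pochhammer (complex_of_real (real n + \<alpha> + \<beta> + 1)) k * pochhammer (- of_nat n) k
        / pochhammer (of_real (\<alpha> + 1)) k)" if "\<alpha> > -1" "k \<le> n" for \<alpha> \<beta> k
    unfolding c_def jacobi_coefficient_pochhammer[OF that] pochhammer_of_real
    by (simp flip: pochhammer_of_real)
  \<comment> \<open>The sign (-1)^k from \<open>c\<close> meets the power of -1 / (\<i> * \<xi>),
    and the 2^k comes from \<open>q\<close>; together they give the argument 1 / (2 * \<i> *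
    \<xi>).\<close>
  have at_1: "(\<Sum>k\<le>n. of_real (poly ((pderiv ^^ k) p) 1) * (- 1 / (\<i> * \<xi>)) ^ k)
      = of_real (pochhammer (\<alpha> + 1) n) / fact n
        * hyp3F1_term (of_real (real n + \<alpha> + \<beta> + 1)) n 1 (of_real (\<alpha> + 1)) (1 / (2 * \<i> * \<xi>))"
    unfolding hyp3F1_term_def sum_distrib_left atLeast0AtMost
  proof (rule sum.cong)
    fix k assume "k \<in> {..n}"
    then have "complex_of_real (poly ((pderiv ^^ k) p) 1) = of_real (fact k * c \<alpha> \<beta> k) / 2 ^ k"
      by (simp add: p_def poly_higher_pderiv_shift coeff_q)
    moreover have "(1 / (2 * \<i> * \<xi>)) ^ k = (-1) ^ k / 2 ^ k * (- 1 / (\<i> * \<xi>)) ^ k"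
      by (simp add: mult.assoc flip: power_mult_distrib power_divide)
    moreover note c[of \<alpha> k \<beta>]
    ultimately show "of_real (poly ((pderiv ^^ k) p) 1) * (- 1 / (\<i> * \<xi>)) ^ k
      = of_real (pochhammer (\<alpha> + 1) n) / fact n
        * (pochhammer (of_real (real n + \<alpha> + \<beta> + 1)) k * pochhammer (- of_nat n) k * pochhammer 1 k
          / (pochhammer (of_real (\<alpha> + 1)) k * fact k) * (1 / (2 * \<i> * \<xi>)) ^ k)"
      using \<open>k \<in> {..n}\<close> assms
      by (simp only: atMost_iff pochhammer_fact[symmetric]) (simp add: mult_ac)
  qed simp
  \<comment> \<open>The powers of -1/2 in \<open>r\<close> bring a second (-1)^k, so the argument
    changes sign; the factor (-1)^n comes from the reflection.\<close>
  have at_m1: "(\<Sum>k\<le>n. of_real (poly ((pderiv ^^ k) p) (-1)) * (- 1 / (\<i> * \<xi>)) ^ k)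
      = (-1) ^ n * of_real (pochhammer (\<beta> + 1) n) / fact n
        * hyp3F1_term (of_real (real n + \<alpha> + \<beta> + 1)) n 1 (of_real (\<beta> + 1)) (- 1 / (2 * \<i> * \<xi>))"
    unfolding hyp3F1_term_def sum_distrib_left atLeast0AtMost
  proof (rule sum.cong)
    fix k assume "k \<in> {..n}"
    then have "complex_of_real (poly ((pderiv ^^ k) p) (-1))
        = (-1) ^ n * of_real (fact k * c \<beta> \<alpha> k) * ((-1) ^ k / 2 ^ k)"
      unfolding p' poly_higher_pderiv_shift by (simp add: coeff_r mult_ac flip: power_divide)
    moreover have "(- 1 / (2 * \<i> * \<xi>)) ^ k = (-1) ^ k * ((-1) ^ k / 2 ^ k) * (- 1 / (\<i> * \<xi>)) ^ k"
      by (simp add: mult.assoc flip: power_mult_distrib power_divide)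
    moreover note c[of \<beta> k \<alpha>]
    moreover have "real n + \<beta> + \<alpha> + 1 = real n + \<alpha> + \<beta> + 1"
      by simp
    ultimately show "of_real (poly ((pderiv ^^ k) p) (-1)) * (- 1 / (\<i> * \<xi>)) ^ k
      = (-1) ^ n * of_real (pochhammer (\<beta> + 1) n) / fact n
        * (pochhammer (of_real (real n + \<alpha> + \<beta> + 1)) k * pochhammer (- of_nat n) k * pochhammer 1 k
          / (pochhammer (of_real (\<beta> + 1)) k * fact k) * (- 1 / (2 * \<i> * \<xi>)) ^ k)"
      using \<open>k \<in> {..n}\<close> assms
      by (simp only: atMost_iff pochhammer_fact[symmetric]) (simp add: mult_ac)
  qed simp
  have "jacobi_hat n \<alpha> \<beta> \<xi> = integral {-1..1} (\<lambda>x. of_real (poly p x) * exp (\<i> * \<xi> * of_real x))"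
    by (simp add: jacobi_hat_def p)
  \<comment> \<open>The lower endpoint enters with a minus sign, which turns (-1)^n into (-1)^(n +
    1).\<close>
  also note integral_unique[OF has_integral_poly_exp[OF \<open>degree p \<le> n\<close>, of "\<i> * \<xi>" "-1" 1]]
  finally show ?thesis
    using \<open>\<xi> \<noteq> 0\<close> unfolding at_1 at_m1 by (simp add: field_simps)
qed

end
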